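(* Let $n$ be a positive integer with $n \equiv 1 \pmod 2$. Then the number of distinct maximum genus embeddings of the complete bipartite graph $K_{n,n}$ is at least $$2^{\frac{n-1}{2}} \times \big((n-2)!!\big)^{n} \times \big((n-1)!\big)^{n}.$$
   Context: $K_{n,n}$ is the simple graph whose vertex set is the disjoint union of $X=\{x_1,\dots,x_n\}$ and $Y=\{y_1,\dots,y_n\}$, in which every vertex of $X$ is joined to every vertex of $Y$ and there are no other edges. A surface is a compact connected 2-manifold without boundary. A cellular embedding of a connected finite graph $G$ into a surface $S$ is an embedding (one-to-one map) $\psi: G \to S$ such that each component (face) of $S - \psi(G)$ is homeomorphic to an open disc. The maximum genus $\gamma_M(G)$ of a connected graph $G$ is the largest integer $k$ such that $G$ has a cellular embedding into the orientable surface of genus $k$. A maximum genus embedding of $G$ is a cellular embedding of $G$ into the orientable surface of genus $\gamma_M(G)$. Embeddings are counted as labelled (oriented) embeddings, i.e. via rotation systems: a rotation system of $G$ assigns to each vertex a cyclic ordering of the edges incident with it, each rotation system determines a cellular embedding of $G$ in an oriented surface, and two embeddings are distinct if their rotation systems are different. Thus the total number of orientable embeddings of a connected simple graph $G$ with at least one edge is $\prod_{v\in V(G)}(d(v)-1)!$, where $d(v)$ is the degree of $v$. For an odd positive integer $m$, $m!! = m(m-2)(m-4)\cdots 3\cdot 1$, and $(-1)!! = 1$. *)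

theory Defs
  imports "Graph_Theory.Graph_Theory" "HOL-Combinatorics.Orbits"
begin

text \<open>
  Cellular embeddings of a finite simple graph in oriented surfaces are represented by rotation
  systems. As in \<^theory>\<open>Graph_Theory.Pair_Digraph\<close>, a simple graph is a symmetric loop-free
  digraph, so an undirected edge is a pair of opposite arcs. The edges incident with \<open>v\<close> correspond
  to the arcs with tail \<open>v\<close>, and a rotation system cyclically permutes these at every vertex.
  A rotation system is required to be the identity outside the arcs of the graph, so that distinct
  functions are distinct rotation systems.
\<close>

definition rotation_system :: "'a pair_pre_digraph \<Rightarrow> ('a \<times> 'a \<Rightarrow> 'a \<times> 'a) \<Rightarrow> bool" where
  "rotation_system G \<rho> \<longleftrightarrow>
     \<rho> permutes parcs G \<and>
     (\<forall>v \<in> pverts G. out_arcs (with_proj G) v \<noteq> {} \<longrightarrow>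
        cyclic_on \<rho> (out_arcs (with_proj G) v))"

definition undirected_edges :: "'a pair_pre_digraph \<Rightarrow> 'a set set" where
  "undirected_edges G = {{u, v} | u v. (u, v) \<in> parcs G}"

text \<open>
  Face tracing: after traversing \<open>(u, v)\<close>, leave \<open>v\<close> along the successor of \<open>(v, u)\<close> in the rotation
  at \<open>v\<close>. The orbits are the boundary walks of the faces.
\<close>

definition faces :: "'a pair_pre_digraph \<Rightarrow> ('a \<times> 'a \<Rightarrow> 'a \<times> 'a) \<Rightarrow> ('a \<times> 'a) set set" where
  "faces G \<rho> = (\<lambda>a. orbit (\<rho> \<circ> swap_in (parcs G)) a) ` parcs G"

text \<open>
  Attaching a disc along every face boundary walk gives a closed oriented surface. For a connected
  graph with at least one edge that surface is connected, and its genus is given by the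
  Euler-Poincare formula \<open>V - E + F = 2 - 2g\<close>. The notions below are meant for such graphs only.
\<close>

definition has_genus :: "'a pair_pre_digraph \<Rightarrow> ('a \<times> 'a \<Rightarrow> 'a \<times> 'a) \<Rightarrow> nat \<Rightarrow> bool" where
  "has_genus G \<rho> g \<longleftrightarrow>
     int (card (pverts G)) - int (card (undirected_edges G)) + int (card (faces G \<rho>))
       = 2 - 2 * int g"

definition max_genus :: "'a pair_pre_digraph \<Rightarrow> nat" where
  "max_genus G = (GREATEST k. \<exists>\<rho>. rotation_system G \<rho> \<and> has_genus G \<rho> k)"

definition max_genus_embeddings :: "'a pair_pre_digraph \<Rightarrow> ('a \<times> 'a \<Rightarrow> 'a \<times> 'a) set" where
  "max_genus_embeddings G = {\<rho>. rotation_system G \<rho> \<and> has_genus G \<rho> (max_genus G)}"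

text \<open>The argument is an integer so that \<open>(-1)!! = 1\<close> makes sense.\<close>

function double_fact :: "int \<Rightarrow> nat" where
  "double_fact m = (if m \<le> 0 then 1 else nat m * double_fact (m - 2))"
  by auto
termination by (relation "measure nat") auto

declare double_fact.simps [simp del]

lemma "double_fact (-1) = 1" "double_fact 1 = 1" "double_fact 7 = 7 * 5 * 3 * 1"
  by (simp_all add: double_fact.simps)

end

theory Submission
  imports Defs
begin

text \<open>
  For odd \<open>n\<close> the Euler-Poincare formula allows \<open>K\<^bsub>n,n\<^esub>\<close> an embedding with a single face, and
  such an embedding has the largest possible genus (\<open>max_genus_eq_of_one_face\<close>). So it suffices to
  find enough rotation systems \<open>\<rho>\<close> for which \<open>\<rho> \<circ> swap_in (parcs G)\<close> is one cycle on the arcs.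
  Let \<open>U\<close> and \<open>V\<close> be the colour classes, and prescribe the cyclic orders at the vertices one after
  the other, where a vertex not yet treated counts as a set of separate pendant ends: \<open>\<rho>\<close> is the
  identity on its arcs.

  The rotations at \<open>U\<close> are arbitrary. They cut the surface into one face per star of a vertex of
  \<open>U\<close>. The first vertex \<open>y\<close> of \<open>V\<close> has exactly one arc in each of these faces, so every rotation at
  \<open>y\<close> merges all of them into one face (\<open>cyclic_on_merge\<close>). This gives \<open>(n-1)! ^ (n + 1)\<close> choices.

  For each other vertex of \<open>V\<close>, its \<open>n\<close> pendant ends are tied together two at a time, beginning with
  a single one, such that a single face persists. If \<open>d\<close> of its ends are tied, then the next end can
  be inserted at any of the \<open>d\<close> corners. This splits the face in two, each of which still has a
  corner at the vertex, so that the following end can be tied to the face that does not contain it,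
  and the two faces merge again (\<open>cyclic_on_insert_two\<close>). Hence there are at least
  \<open>1 \<cdot> 3 \<cdot> \<dots> \<cdot> (n-2)\<close> rotations at this vertex that keep one face (\<open>card_one_cycle_extensions\<close>).

  The product of these numbers is \<open>(n-1)! ^ (n + 1) \<cdot> (n-2)!! ^ (n - 1)\<close>, and the surplus factor
  \<open>(n-1)!\<close> equals \<open>2 ^ ((n-1) / 2) \<cdot> ((n-1) / 2)! \<cdot> (n-2)!!\<close>.
\<close>

section \<open>Merging and splitting cycles\<close>

text \<open>
  Following \<open>c \<circ> f\<close> from \<open>s \<in> C\<close>, one runs through the whole \<open>f\<close>-cycle of \<open>s\<close> because \<open>c\<close> moves
  nothing there except \<open>s\<close>; on closing that cycle, \<open>c\<close> diverts the walk to the cycle of \<open>c s\<close>.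
\<close>

lemma cyclic_on_merge:
  assumes c: "cyclic_on c C"
    and f: "\<And>s. s \<in> C \<Longrightarrow> cyclic_on f (Z s)"
    and transversal: "\<And>s. s \<in> C \<Longrightarrow> Z s \<inter> C = {s}"
    and fixed: "\<And>x. x \<in> (\<Union>s\<in>C. Z s) \<Longrightarrow> x \<notin> C \<Longrightarrow> c x = x"
  shows "cyclic_on (c \<circ> f) (\<Union>s\<in>C. Z s)"
proof -
  let ?g = "c \<circ> f" and ?T = "\<Union>s\<in>C. Z s"
  have C_sub: "C \<subseteq> ?T" using transversal by blast
  have c_T: "c x \<in> ?T" if "x \<in> ?T" for x
    using that fixed[of x] cyclic_on_inI[OF c, of x] C_sub by (cases "x \<in> C") auto
  have f_T: "f x \<in> ?T" if "x \<in> ?T" for x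
    using that cyclic_on_inI[OF f] by blast
  have walk: "c z \<in> orbit ?g s" if s: "s \<in> C" and z: "z \<in> Z s" for s z
  proof -
    have Z: "Z s = orbit f s"
      using orbit_cyclic_eq3[OF f[OF s]] transversal[OF s] by blast
    have "z \<in> orbit f s" using z Z by simp
    then show ?thesis
    proof induction
      case base
      show ?case using orbit.base[of ?g s] by (simp add: comp_def)
    next
      case (step y)
      show ?case
      proof (cases "y = s")
        case True
        then show ?thesis using orbit.base[of ?g s] by (simp add: comp_def)
      next
        case False
        then have "y \<notin> C" using transversal[OF s] step.hyps Z by blast
        then have "c y = y" using step.hyps Z s by (intro fixed) auto
        then show ?thesis using orbit.step[OF step.IH] by (simp only: o_apply)
      qed
    qed
  qed
  obtain s0 where s0: "s0 \<in> C" "C = orbit c s0" using c unfolding cyclic_on_def by blast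
  have C_reached: "s \<in> orbit ?g s0" if "s \<in> C" for s
  proof -
    have "s \<in> orbit c s0" using that s0 by simp
    then show ?thesis
    proof induction
      case base
      show ?case using s0(1) transversal[OF s0(1)] by (intro walk) auto
    next
      case (step y)
      then have "y \<in> C" using s0 by simp
      then have "c y \<in> orbit ?g y" using transversal[of y] by (intro walk) auto
      then show ?case using step.IH by (rule orbit_trans)
    qed
  qed
  have "?T = orbit ?g s0"
  proof
    show "?T \<subseteq> orbit ?g s0"
    proof
      fix z assume "z \<in> ?T"
      then obtain s where s: "s \<in> C" "z \<in> Z s" by blast
      show "z \<in> orbit ?g s0"
      proof (cases "z \<in> C")
        case False
        then have "c z = z" using s by (intro fixed) auto
        then have "z \<in> orbit ?g s" using walk[OF s] by simp
        then show ?thesis using C_reached[OF s(1)] by (rule orbit_trans)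
      qed (rule C_reached)
    qed
  next
    have "s0 \<in> ?T" using s0 C_sub by blast
    show "orbit ?g s0 \<subseteq> ?T"
    proof
      fix z assume "z \<in> orbit ?g s0"
      then show "z \<in> ?T"
        by induction (simp_all only: o_apply c_T[OF f_T] \<open>s0 \<in> ?T\<close>)
    qed
  qed
  then show ?thesis using s0 C_sub by (intro cyclic_on_singleI[of s0]) auto
qed

lemma cyclic_on_transpose: "cyclic_on (transpose p q) {p, q}"
proof (rule cyclic_on_singleI)
  show "{p, q} = orbit (transpose p q) p"
  proof
    have q: "q \<in> orbit (transpose p q) p" using orbit.base[of "transpose p q" p] by simp
    then have "p \<in> orbit (transpose p q) p" using orbit.step by fastforce
    with q show "{p, q} \<subseteq> orbit (transpose p q) p" by simp
    show "orbit (transpose p q) p \<subseteq> {p, q}"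
    proof
      fix z assume "z \<in> orbit (transpose p q) p"
      then show "z \<in> {p, q}" by induction auto
    qed
  qed
qed simp

lemma cyclic_on_transpose_merge:
  assumes "cyclic_on f A" "cyclic_on f B" "A \<inter> B = {}" "p \<in> A" "q \<in> B"
  shows "cyclic_on (transpose p q \<circ> f) (A \<union> B)"
proof -
  have pq: "p \<noteq> q" using assms by blast
  have "cyclic_on (transpose p q \<circ> f) (\<Union>s\<in>{p, q}. if s = p then A else B)"
    by (rule cyclic_on_merge) (use assms pq in \<open>auto simp: cyclic_on_transpose transpose_def\<close>)
  then show ?thesis using pq by (simp add: Un_commute)
qed

text \<open>
  The transposition sends the predecessors of \<open>q\<close> and \<open>p\<close> to \<open>p\<close> and \<open>q\<close>, so it closes up the path
  from \<open>p\<close> to the predecessor of \<open>q\<close> as well as the path from \<open>q\<close> to the predecessor of \<open>p\<close>.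
\<close>

lemma cyclic_on_transpose_split:
  assumes f: "f permutes E" "cyclic_on f E" and pq: "p \<in> E" "q \<in> E" "p \<noteq> q"
  obtains A B where "cyclic_on (transpose p q \<circ> f) A" "cyclic_on (transpose p q \<circ> f) B"
    "A \<inter> B = {}" "A \<union> B = E" "p \<in> A" "q \<in> B"
proof -
  let ?g = "transpose p q \<circ> f"
  have fin: "finite E" using finite_cyclic_on f by blast
  have g: "?g permutes E"
    using f pq by (intro permutes_compose permutes_swap_id)
  have self: "x \<in> orbit ?g x" for x
    using g fin by (intro permutation_self_in_orbit) (auto simp: permutation_permutes)
  have cover: "z \<in> orbit ?g p \<union> orbit ?g q" if "z \<in> E" for z
  proof -
    have "z \<in> orbit f p" using that orbit_cyclic_eq3[OF f(2) pq(1)] by simp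
    moreover have "f y \<in> orbit ?g p \<union> orbit ?g q" if "y \<in> orbit ?g p \<union> orbit ?g q" for y
    proof (cases "f y = p \<or> f y = q")
      case False
      then have "f y = ?g y" by (simp add: transpose_def)
      then show ?thesis using that orbit.step[of y ?g] by auto
    qed (use self in auto)
    ultimately show ?thesis
      by induction (use self in blast)+
  qed
  have "q \<notin> orbit ?g p"
  proof
    assume q: "q \<in> orbit ?g p"
    define k where "k = funpow_dist1 f p q"
    have k: "(f ^^ k) p = q" "0 < k" "\<And>i. 0 < i \<Longrightarrow> i < k \<Longrightarrow> (f ^^ i) p \<noteq> q"
      using funpow_dist1_prop[of q f p] funpow_dist1_least[of _ f p q]
        orbit_cyclic_eq3[OF f(2) pq(1)] pq(2) by (auto simp: k_def)
    have no_return: "(f ^^ i) p \<noteq> p" if "0 < i" "i < k" for i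
    proof
      assume "(f ^^ i) p = p"
      moreover have "(f ^^ ((k - i) + i)) p = q" using k that by simp
      ultimately have "(f ^^ (k - i)) p = q" by (simp only: funpow_add o_apply)
      then show False using k(3)[of "k - i"] that by simp
    qed
    have "z \<in> (\<lambda>i. (f ^^ i) p) ` {..<k}" if "z \<in> orbit ?g p" for z
    proof -
      have step: "?g ((f ^^ i) p) \<in> (\<lambda>i. (f ^^ i) p) ` {..<k}" if "i < k" for i
      proof (cases "Suc i = k")
        case True
        then have "?g ((f ^^ i) p) = (f ^^ 0) p" using k(1) by auto
        then show ?thesis using k(2) by blast
      next
        case False
        then have "?g ((f ^^ i) p) = (f ^^ Suc i) p"
          using that k(3)[of "Suc i"] no_return[of "Suc i"] by (simp add: transpose_def)
        then show ?thesis using that False by (intro image_eqI[of _ _ "Suc i"]) auto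
      qed
      show ?thesis using that
      proof induction
        case base
        show ?case using step[of 0] k(2) by simp
      next
        case (step y)
        then show ?case using \<open>\<And>i. i < k \<Longrightarrow> ?g ((f ^^ i) p) \<in> _\<close> by blast
      qed
    qed
    then obtain i where "i < k" "q = (f ^^ i) p" using q by blast
    then show False using k(3)[of i] pq(3) by (cases "i = 0") auto
  qed
  moreover have "q \<in> orbit ?g p" if "x \<in> orbit ?g p" "x \<in> orbit ?g q" for x
    using that orbit_swap[OF self] orbit_trans by metis
  ultimately have disj: "orbit ?g p \<inter> orbit ?g q = {}" by blast
  show thesis
  proof (rule that)
    show "orbit ?g p \<union> orbit ?g q = E"
      using cover permutes_orbit_subset[OF g] pq by blast
  qed (use cyclic_on_orbit[OF g fin] disj self in blast)+
qed

section \<open>Cyclic permutations with one cycle in a product\<close>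

definition cyclic_perms :: "'a set \<Rightarrow> ('a \<Rightarrow> 'a) set" where
  "cyclic_perms C = {c. c permutes C \<and> cyclic_on c C}"

lemma finite_cyclic_perms: "finite C \<Longrightarrow> finite (cyclic_perms C)"
  unfolding cyclic_perms_def by (rule finite_subset[OF _ finite_permutations]) auto

lemma id_in_cyclic_perms: "id \<in> cyclic_perms {s}"
  using cyclic_on_transpose[of s s] by (simp add: cyclic_perms_def permutes_id)

text \<open>The composite inserts \<open>a\<close> directly before \<open>s\<close> in the cyclic order \<open>c\<close>.\<close>

lemma insert_in_cyclic_perms:
  assumes c: "c \<in> cyclic_perms C" and "a \<notin> C" "s \<in> C"
  shows "transpose a s \<circ> c \<in> cyclic_perms (insert a C)"
proof -
  have "c permutes C" "cyclic_on c C" using c by (auto simp: cyclic_perms_def)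
  moreover have "cyclic_on c {a}"
    using permutes_not_in[OF \<open>c permutes C\<close> \<open>a \<notin> C\<close>]
    by (intro cyclic_on_singleI) (auto simp: orbit_eq_singleton_iff[THEN iffD2])
  ultimately have "cyclic_on (transpose a s \<circ> c) ({a} \<union> C)"
    using assms by (intro cyclic_on_transpose_merge) auto
  moreover have "transpose a s \<circ> c permutes insert a C"
    using \<open>c permutes C\<close> assms
    by (intro permutes_compose permutes_swap_id) (auto intro: permutes_subset)
  ultimately show ?thesis by (simp add: cyclic_perms_def)
qed

text \<open>The inserted element remembers its position, and removing it gives back the old order.\<close>

lemma inj_on_insert_cyclic_perms:
  assumes "a \<notin> C"
  shows "inj_on (\<lambda>(c, s). transpose a s \<circ> c) (cyclic_perms C \<times> UNIV)"
proof (rule inj_onI, clarify)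
  fix c s c' s'
  assume c: "c \<in> cyclic_perms C" "c' \<in> cyclic_perms C"
    and eq: "transpose a s \<circ> c = transpose a s' \<circ> c'"
  have "c a = a" "c' a = a"
    using c assms by (auto simp: cyclic_perms_def permutes_not_in)
  then have s: "s = s'" using fun_cong[OF eq, of a] by simp
  have "transpose a s \<circ> (transpose a s \<circ> c) = transpose a s \<circ> (transpose a s \<circ> c')"
    using eq s by simp
  then show "c = c' \<and> s = s'" using s by (simp add: o_assoc)
qed

lemma card_cyclic_perms_ge:
  assumes "finite C" "C \<noteq> {}"
  shows "fact (card C - 1) \<le> card (cyclic_perms C)"
  using assms
proof (induction rule: finite_ne_induct)
  case (singleton s)
  have "card {id :: 'a \<Rightarrow> 'a} \<le> card (cyclic_perms {s})"
    using id_in_cyclic_perms[of s] by (intro card_mono finite_cyclic_perms) auto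
  then show ?case by simp
next
  case (insert a C)
  have "fact (card (insert a C) - 1) = fact (card C - 1) * card C"
    using insert.hyps by (simp add: fact_reduce[of "card C"] card_gt_0_iff)
  also have "\<dots> \<le> card (cyclic_perms C \<times> C)"
    using insert.IH by (simp add: card_cartesian_product)
  also have "\<dots> \<le> card (cyclic_perms (insert a C))"
  proof (rule card_inj_on_le)
    show "inj_on (\<lambda>(c, s). transpose a s \<circ> c) (cyclic_perms C \<times> C)"
      using inj_on_insert_cyclic_perms[OF \<open>a \<notin> C\<close>] by (rule inj_on_subset) auto
    show "(\<lambda>(c, s). transpose a s \<circ> c) ` (cyclic_perms C \<times> C) \<subseteq> cyclic_perms (insert a C)"
      using insert_in_cyclic_perms[OF _ \<open>a \<notin> C\<close>] by auto
  qed (use insert.hyps in \<open>auto intro: finite_cyclic_perms\<close>)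
  finally show ?case .
qed

text \<open>
  Inserting \<open>a\<close> before \<open>s\<close> splits the cycle \<open>f\<close> into one part through \<open>a\<close> and one through \<open>s\<close>. The
  element \<open>b\<close> lies in one of them, and inserting it before the representative of the other part
  restores a single cycle.
\<close>

lemma cyclic_on_insert_two:
  assumes f: "f permutes E" "cyclic_on f E" and E: "a \<in> E" "b \<in> E" "s \<in> E"
    and "a \<noteq> s" "b \<noteq> a" "b \<noteq> s"
  obtains t where "t \<in> {a, s}" "cyclic_on (transpose b t \<circ> (transpose a s \<circ> f)) E"
proof -
  obtain A B where AB: "cyclic_on (transpose a s \<circ> f) A" "cyclic_on (transpose a s \<circ> f) B"
    "A \<inter> B = {}" "A \<union> B = E" "a \<in> A" "s \<in> B"
    using cyclic_on_transpose_split[OF f E(1,3) \<open>a \<noteq> s\<close>] by metis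
  show thesis
  proof (cases "b \<in> A")
    case True
    then show ?thesis
      using cyclic_on_transpose_merge[OF AB(1-3) True AB(6)] AB(4) by (intro that[of s]) auto
  next
    case False
    then have "b \<in> B" using AB E by blast
    then show ?thesis
      using cyclic_on_transpose_merge[OF AB(2,1) _ _ AB(5)] AB(3,4)
      by (intro that[of a]) (auto simp: Int_commute Un_commute)
  qed
qed

lemma double_fact_of_nat_Suc:
  "double_fact (int (2 * Suc m + 1) - 2) = (2 * m + 1) * double_fact (int (2 * m + 1) - 2)"
  by (subst double_fact.simps) (simp add: nat_add_distrib nat_mult_distrib algebra_simps)

text \<open>
  Of \<open>C = D \<union> {a, b}\<close>, the set \<open>D\<close> is ordered first. Every position \<open>s \<in> D\<close> for \<open>a\<close> can be completed
  by some position for \<open>b\<close>, and \<open>s\<close> can be read off from the result. So two more elements multiply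
  the number by at least \<open>card D\<close>, and the odd numbers below \<open>card C\<close> accumulate.
\<close>

lemma card_one_cycle_extensions:
  assumes f: "f permutes E" "cyclic_on f E" and "C \<subseteq> E" "odd (card C)"
  shows "double_fact (int (card C) - 2) \<le> card {c \<in> cyclic_perms C. cyclic_on (c \<circ> f) E}"
proof -
  have fin: "finite C" if "C \<subseteq> E" for C
    using finite_cyclic_on[OF f(2)] that finite_subset by blast
  define S where "S C = {c \<in> cyclic_perms C. cyclic_on (c \<circ> f) E}" for C
  have fin_S: "finite (S C)" if "C \<subseteq> E" for C
    using finite_cyclic_perms[OF fin[OF that]] by (simp add: S_def)
  have "double_fact (int (2 * m + 1) - 2) \<le> card (S C)" if "C \<subseteq> E" "card C = 2 * m + 1" for C m
    using that
  proof (induction m arbitrary: C)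
    case 0
    then obtain s where C: "C = {s}" by (auto simp: card_1_singleton_iff)
    have "card {id :: 'a \<Rightarrow> 'a} \<le> card (S C)"
      using f id_in_cyclic_perms[of s] 0 by (intro card_mono fin_S) (auto simp: S_def C)
    then show ?case by (simp add: double_fact.simps)
  next
    case (Suc m)
    obtain a where a: "a \<in> C" using Suc.prems by fastforce
    have card_a: "card (C - {a}) = 2 * m + 2" using Suc.prems a fin by simp
    then obtain b where b: "b \<in> C - {a}" by (metis add_2_eq_Suc' card.empty ex_in_conv nat.distinct(1))
    define D where "D = C - {a} - {b}"
    have card_D: "card D = 2 * m + 1" using card_a b fin[OF Suc.prems(1)] by (simp add: D_def)
    have C: "C = insert b (insert a D)" "a \<notin> D" "b \<notin> insert a D" "D \<subseteq> E" "a \<in> E" "b \<in> E"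
      using a b Suc.prems by (auto simp: D_def)
    have "\<exists>t. t \<in> insert a D \<and> cyclic_on (transpose b t \<circ> (transpose a s \<circ> (c \<circ> f))) E"
      if "c \<in> S D" "s \<in> D" for c s
    proof -
      have "c permutes E" using that C by (auto simp: S_def cyclic_perms_def intro: permutes_subset)
      then have "c \<circ> f permutes E" using f by (intro permutes_compose)
      moreover have "cyclic_on (c \<circ> f) E" using that by (simp add: S_def)
      moreover have "s \<in> E" "a \<noteq> s" "b \<noteq> a" "b \<noteq> s" using that C by auto
      ultimately obtain t where "t \<in> {a, s}"
        "cyclic_on (transpose b t \<circ> (transpose a s \<circ> (c \<circ> f))) E"
        using cyclic_on_insert_two[of "c \<circ> f" E a b s] C by blast
      then show ?thesis using \<open>s \<in> D\<close> by blast
    qed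
    then obtain t where t: "\<And>c s. c \<in> S D \<Longrightarrow> s \<in> D \<Longrightarrow> t c s \<in> insert a D"
      "\<And>c s. c \<in> S D \<Longrightarrow> s \<in> D \<Longrightarrow>
        cyclic_on (transpose b (t c s) \<circ> (transpose a s \<circ> (c \<circ> f))) E"
      by metis
    let ?ins = "\<lambda>(c, s). transpose b (t c s) \<circ> (transpose a s \<circ> c)"
    have "double_fact (int (2 * Suc m + 1) - 2) \<le> card (S D \<times> D)"
      using mult_le_mono2[OF Suc.IH[OF \<open>D \<subseteq> E\<close> card_D], of "card D"]
      unfolding double_fact_of_nat_Suc card_cartesian_product card_D by (simp only: mult.commute)
    also have "\<dots> \<le> card (S C)"
    proof (rule card_inj_on_le)
      show "inj_on ?ins (S D \<times> D)"
      proof (rule inj_onI, clarify)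
        fix c s c' s'
        assume c: "c \<in> S D" "s \<in> D" "c' \<in> S D" "s' \<in> D"
          and eq: "transpose b (t c s) \<circ> (transpose a s \<circ> c)
            = transpose b (t c' s') \<circ> (transpose a s' \<circ> c')"
        then have D: "c \<in> cyclic_perms D" "c' \<in> cyclic_perms D" by (auto simp: S_def)
        have "transpose a s \<circ> c = transpose a s' \<circ> c'"
          using inj_onD[OF inj_on_insert_cyclic_perms[OF C(3)],
              of "(transpose a s \<circ> c, t c s)" "(transpose a s' \<circ> c', t c' s')"]
            insert_in_cyclic_perms[OF _ C(2)] D c eq by auto
        then show "c = c' \<and> s = s'"
          using inj_onD[OF inj_on_insert_cyclic_perms[OF C(2)], of "(c, s)" "(c', s')"] D by auto
      qed
      show "?ins ` (S D \<times> D) \<subseteq> S C"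
      proof clarify
        fix c s assume c: "c \<in> S D" "s \<in> D"
        have "transpose b (t c s) \<circ> (transpose a s \<circ> c) \<in> cyclic_perms C"
          unfolding C(1) using c t(1)[OF c] C
          by (intro insert_in_cyclic_perms) (auto simp: S_def)
        then show "transpose b (t c s) \<circ> (transpose a s \<circ> c) \<in> S C"
          using t(2)[OF c] by (simp add: S_def o_assoc)
      qed
      show "finite (S C)" using Suc.prems by (intro fin_S)
    qed
    finally show ?case .
  qed
  moreover obtain m where "card C = 2 * m + 1" using \<open>odd (card C)\<close> by (rule oddE)
  ultimately show ?thesis using \<open>C \<subseteq> E\<close> unfolding S_def by presburger
qed

section \<open>Choosing the rotations vertex by vertex\<close>

text \<open>
  Partial rotation systems: they are the identity away from \<open>W\<close>, so that composing with a cyclic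
  permutation of \<open>B v\<close> prescribes the rotation at a further vertex \<open>v\<close>.
\<close>

definition rotations_on :: "('v \<Rightarrow> 'b set) \<Rightarrow> 'v set \<Rightarrow> ('b \<Rightarrow> 'b) set" where
  "rotations_on B W = {\<rho>. \<rho> permutes (\<Union>v\<in>W. B v) \<and> (\<forall>v\<in>W. cyclic_on \<rho> (B v))}"

lemma finite_rotations_on:
  assumes "finite W" "\<And>v. v \<in> W \<Longrightarrow> finite (B v)"
  shows "finite (rotations_on B W)"
  unfolding rotations_on_def
  by (rule finite_subset[OF _ finite_permutations[of "\<Union>v\<in>W. B v"]]) (use assms in auto)

lemma comp_in_rotations_on:
  assumes \<rho>: "\<rho> \<in> rotations_on B W" and c: "c \<in> cyclic_perms (B v)"
    and disj: "B v \<inter> (\<Union>w\<in>W. B w) = {}"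
  shows "c \<circ> \<rho> \<in> rotations_on B (insert v W)"
proof -
  have \<rho>': "\<rho> permutes (\<Union>w\<in>W. B w)" "\<And>w. w \<in> W \<Longrightarrow> cyclic_on \<rho> (B w)"
    using \<rho> by (auto simp: rotations_on_def)
  have c': "c permutes B v" "cyclic_on c (B v)" using c by (auto simp: cyclic_perms_def)
  have "c \<circ> \<rho> permutes (\<Union>w\<in>insert v W. B w)"
    using \<rho>'(1) c'(1) by (intro permutes_compose) (auto intro: permutes_subset)
  moreover have "cyclic_on (c \<circ> \<rho>) (B v)"
    using permutes_comp_preserves_cyclic1[OF \<rho>'(1) c'(2) disj] by simp
  moreover have "cyclic_on (c \<circ> \<rho>) (B w)" if "w \<in> W" for w
    using permutes_comp_preserves_cyclic2[OF c'(1) \<rho>'(2)[OF that] disj] that by blast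
  ultimately show ?thesis by (auto simp: rotations_on_def)
qed

text \<open>
  Both \<open>\<rho>\<close> and \<open>c\<close> are recovered from \<open>c \<circ> \<rho>\<close> because they move disjoint sets, so the numbers of
  choices multiply. The predicates differ to allow for a vertex whose rotation establishes a
  property that was absent before.
\<close>

lemma card_rotations_on_insert:
  assumes fin: "finite W" "\<And>w. w \<in> insert v W \<Longrightarrow> finite (B w)"
    and disj: "B v \<inter> (\<Union>w\<in>W. B w) = {}"
    and N: "\<And>\<rho>. \<rho> \<in> rotations_on B W \<Longrightarrow> P \<rho> \<Longrightarrow>
      N \<le> card {c \<in> cyclic_perms (B v). Q (c \<circ> \<rho>)}"
  shows "N * card {\<rho> \<in> rotations_on B W. P \<rho>} \<le> card {\<rho> \<in> rotations_on B (insert v W). Q \<rho>}"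
proof -
  let ?R = "{\<rho> \<in> rotations_on B W. P \<rho>}" and ?C = "\<lambda>\<rho>. {c \<in> cyclic_perms (B v). Q (c \<circ> \<rho>)}"
  have fin_R: "finite ?R" using fin finite_rotations_on[of W B] by simp
  have "N * card ?R \<le> (\<Sum>\<rho>\<in>?R. card (?C \<rho>))"
    using sum_mono[of ?R "\<lambda>_. N"] N by (simp add: mult.commute)
  also have "\<dots> = card (Sigma ?R ?C)"
    using fin_R fin finite_cyclic_perms[of "B v"] by (simp add: card_SigmaI)
  also have "\<dots> \<le> card {\<rho> \<in> rotations_on B (insert v W). Q \<rho>}"
  proof (rule card_inj_on_le)
    show "inj_on (\<lambda>(\<rho>, c). c \<circ> \<rho>) (Sigma ?R ?C)"
    proof (rule inj_onI, clarify)
      fix \<rho> c \<rho>' c'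
      assume \<rho>: "\<rho> \<in> rotations_on B W" "\<rho>' \<in> rotations_on B W"
        and c: "c \<in> cyclic_perms (B v)" "c' \<in> cyclic_perms (B v)" and eq: "c \<circ> \<rho> = c' \<circ> \<rho>'"
      have c': "c permutes B v" "c' permutes B v" using c by (auto simp: cyclic_perms_def)
      have "c x = c' x" for x
      proof (cases "x \<in> B v")
        case True
        then have "x \<notin> (\<Union>w\<in>W. B w)" using disj by blast
        then have "\<rho> x = x" "\<rho>' x = x"
          using \<rho> by (auto simp: rotations_on_def permutes_not_in)
        then show ?thesis using fun_cong[OF eq, of x] by simp
      qed (simp add: permutes_not_in[OF c'(1)] permutes_not_in[OF c'(2)])
      then have "c = c'" by blast
      then show "\<rho> = \<rho>' \<and> c = c'"
        using eq permutes_inj[OF c'(2)] by (auto simp: fun_eq_iff inj_eq)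
    qed
    show "(\<lambda>(\<rho>, c). c \<circ> \<rho>) ` Sigma ?R ?C \<subseteq> {\<rho> \<in> rotations_on B (insert v W). Q \<rho>}"
      using comp_in_rotations_on[OF _ _ disj] by auto
    show "finite {\<rho> \<in> rotations_on B (insert v W). Q \<rho>}"
      using fin finite_rotations_on[of "insert v W" B] by simp
  qed
  finally show ?thesis .
qed

lemma card_rotations_on_Un:
  assumes fin: "finite W0" "finite W" "\<And>w. finite (B w)" and "W0 \<inter> W = {}"
    and disj: "\<And>v w. v \<noteq> w \<Longrightarrow> B v \<inter> B w = {}"
    and N: "\<And>\<rho> v W'. v \<in> W \<Longrightarrow> W' \<subseteq> W0 \<union> W \<Longrightarrow> \<rho> \<in> rotations_on B W' \<Longrightarrow> P \<rho> \<Longrightarrow>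
      N \<le> card {c \<in> cyclic_perms (B v). P (c \<circ> \<rho>)}"
  shows "N ^ card W * card {\<rho> \<in> rotations_on B W0. P \<rho>}
    \<le> card {\<rho> \<in> rotations_on B (W0 \<union> W). P \<rho>}"
  using fin(2) \<open>W0 \<inter> W = {}\<close> N
proof (induction W)
  case (insert v W)
  have disj_v: "B v \<inter> (\<Union>w\<in>W0 \<union> W. B w) = {}"
  proof -
    have "v \<noteq> w" if "w \<in> W0 \<union> W" for w using that insert by blast
    then show ?thesis using disj by blast
  qed
  have "N * card {\<rho> \<in> rotations_on B (W0 \<union> W). P \<rho>}
      \<le> card {\<rho> \<in> rotations_on B (insert v (W0 \<union> W)). P \<rho>}"
  proof (rule card_rotations_on_insert)
    fix \<rho> assume "\<rho> \<in> rotations_on B (W0 \<union> W)" "P \<rho>"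
    then show "N \<le> card {c \<in> cyclic_perms (B v). P (c \<circ> \<rho>)}"
      by (intro insert.prems(2)) auto
  qed (use insert.hyps fin disj_v in auto)
  moreover have "N ^ card W * card {\<rho> \<in> rotations_on B W0. P \<rho>}
      \<le> card {\<rho> \<in> rotations_on B (W0 \<union> W). P \<rho>}"
  proof (rule insert.IH)
    fix \<rho> w W'
    assume "w \<in> W" "W' \<subseteq> W0 \<union> W" "\<rho> \<in> rotations_on B W'" "P \<rho>"
    then show "N \<le> card {c \<in> cyclic_perms (B w). P (c \<circ> \<rho>)}"
      by (intro insert.prems(2)) auto
  qed (use insert.prems in auto)
  ultimately show ?case
    using insert.hyps order_trans[OF mult_le_mono2] by (simp add: mult.assoc)
qed simp

section \<open>One-face embeddings have maximum genus\<close>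

lemma faces_of_one_cycle:
  assumes "cyclic_on (\<rho> \<circ> swap_in (parcs G)) (parcs G)"
  shows "faces G \<rho> = {parcs G}"
  using orbit_cyclic_eq3[OF assms] assms by (auto simp: faces_def cyclic_on_def)

text \<open>By the Euler-Poincare formula the genus decreases in the number of faces, which is positive.\<close>

lemma max_genus_eq_of_one_face:
  assumes fin: "finite (parcs G)" "parcs G \<noteq> {}"
    and \<rho>: "rotation_system G \<rho>" "has_genus G \<rho> g" "card (faces G \<rho>) = 1"
  shows "max_genus G = g"
  unfolding max_genus_def
proof (rule Greatest_equality)
  fix k assume "\<exists>\<rho>. rotation_system G \<rho> \<and> has_genus G \<rho> k"
  then obtain \<sigma> where \<sigma>: "has_genus G \<sigma> k" by blast
  have "card (faces G \<sigma>) \<ge> 1"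
    using fin by (simp add: faces_def Suc_le_eq card_gt_0_iff)
  then show "k \<le> g" using \<sigma> \<rho>(2,3) by (simp add: has_genus_def)
qed (use \<rho> in blast)

section \<open>Complete bipartite graphs\<close>

lemma card_undirected_edges_complete_bipartite:
  assumes "parcs G = U \<times> V \<union> V \<times> U" "U \<inter> V = {}"
  shows "card (undirected_edges G) = card U * card V"
proof -
  have "undirected_edges G = (\<lambda>(u, v). {u, v}) ` (U \<times> V)"
    using assms by (auto simp: undirected_edges_def)
  moreover have "inj_on (\<lambda>(u, v). {u, v}) (U \<times> V)"
    using assms(2) by (auto simp: inj_on_def doubleton_eq_iff)
  ultimately show ?thesis by (simp add: card_image card_cartesian_product)
qed

text \<open>
  Both steps are merges: the rotation at \<open>u \<in> U\<close> merges the edges at \<open>u\<close>, each of which is a 2-cycle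
  of the arc reversal, into the star of \<open>u\<close>, and the rotation at \<open>y\<close> merges all these stars.
\<close>

lemma cyclic_on_first_vertex:
  fixes B :: "'a \<Rightarrow> ('a \<times> 'a) set"
  assumes E: "E = U \<times> V \<union> V \<times> U" "U \<inter> V = {}" "U \<noteq> {}" and y: "y \<in> V"
    and B: "\<And>u. u \<in> U \<Longrightarrow> B u = {u} \<times> V"
    and \<rho>: "\<rho> \<in> rotations_on B U" and c: "c \<in> cyclic_perms ({y} \<times> U)"
  shows "cyclic_on (c \<circ> \<rho> \<circ> swap_in E) E"
proof -
  have \<rho>': "\<rho> permutes (U \<times> V)" "\<And>u. u \<in> U \<Longrightarrow> cyclic_on \<rho> ({u} \<times> V)"
    using \<rho> B by (auto simp: rotations_on_def Sigma_def)
  have c': "c permutes ({y} \<times> U)" "cyclic_on c ({y} \<times> U)"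
    using c by (auto simp: cyclic_perms_def)
  have edge: "cyclic_on (swap_in E) {(u, v), (v, u)}" if "u \<in> U" "v \<in> V" for u v
  proof -
    have "cyclic_on (swap_in E) {(u, v), (v, u)} = cyclic_on (transpose (u, v) (v, u)) {(u, v), (v, u)}"
      by (rule cyclic_cong) (use that E in \<open>auto simp: swap_in_def transpose_def\<close>)
    then show ?thesis using cyclic_on_transpose by simp
  qed
  have star: "cyclic_on (\<rho> \<circ> swap_in E) ({u} \<times> V \<union> V \<times> {u})" if u: "u \<in> U" for u
  proof -
    have "cyclic_on (\<rho> \<circ> swap_in E) (\<Union>a\<in>{u} \<times> V. {a, prod.swap a})"
    proof (rule cyclic_on_merge)
      fix x assume "x \<in> (\<Union>a\<in>{u} \<times> V. {a, prod.swap a})" "x \<notin> {u} \<times> V"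
      then show "\<rho> x = x" using u E by (intro permutes_not_in[OF \<rho>'(1)]) auto
    qed (use \<rho>' u E edge in auto)
    moreover have "(\<Union>a\<in>{u} \<times> V. {a, prod.swap a}) = {u} \<times> V \<union> V \<times> {u}" by auto
    ultimately show ?thesis by simp
  qed
  have "cyclic_on (c \<circ> (\<rho> \<circ> swap_in E)) (\<Union>a\<in>{y} \<times> U. {snd a} \<times> V \<union> V \<times> {snd a})"
  proof (rule cyclic_on_merge)
    fix x assume "x \<notin> {y} \<times> U"
    then show "c x = x" using c'(1) by (simp add: permutes_not_in)
  qed (use c' star y E in auto)
  moreover have "(\<Union>a\<in>{y} \<times> U. {snd a} \<times> V \<union> V \<times> {snd a}) = E" using E by auto
  ultimately show ?thesis by (simp add: o_assoc)
qed

lemma fact_ge_double_fact: "2 ^ m * double_fact (int (2 * m + 1) - 2) \<le> fact (2 * m)"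
proof (induction m)
  case 0
  then show ?case by (simp add: double_fact.simps)
next
  case (Suc m)
  have "2 ^ Suc m * double_fact (int (2 * Suc m + 1) - 2)
      = (2 * (2 * m + 1)) * (2 ^ m * double_fact (int (2 * m + 1) - 2))"
    by (simp only: double_fact_of_nat_Suc power_Suc) (simp only: ac_simps)
  also have "\<dots> \<le> ((2 * m + 2) * (2 * m + 1)) * fact (2 * m)"
    using Suc.IH by (intro mult_le_mono) auto
  also have "\<dots> = fact (2 * Suc m)" by (simp add: algebra_simps)
  finally show ?case .
qed

theorem theoremA:
  fixes G :: "'a pair_pre_digraph" and n :: nat
  assumes "n > 0" and "odd n"
    and "complete_bipartite_digraph n n (with_proj G)"
  shows "card (max_genus_embeddings G)
           \<ge> 2 ^ ((n - 1) div 2) * double_fact (int n - 2) ^ n * fact (n - 1) ^ n"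
proof -
  let ?E = "parcs G" and ?d = "double_fact (int n - 2)"
  obtain U V where fin: "finite (pverts G)" and verts: "pverts G = U \<union> V" "U \<inter> V = {}"
    and card: "card U = n" "card V = n" and E: "?E = U \<times> V \<union> V \<times> U"
    using assms(3) unfolding complete_bipartite_digraph_pair_def by blast
  obtain m where n: "n = 2 * m + 1" using \<open>odd n\<close> by (rule oddE)
  have fin': "finite U" "finite V" "finite ?E" using fin verts E by auto
  have ne: "U \<noteq> {}" "V \<noteq> {}" using card \<open>n > 0\<close> by auto
  define B where "B v = out_arcs (with_proj G) v" for v
  have B_U: "B u = {u} \<times> V" if "u \<in> U" for u using that verts E by (auto simp: B_def out_arcs_def)
  have B_V: "B v = {v} \<times> U" if "v \<in> V" for v using that verts E by (auto simp: B_def out_arcs_def)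
  have B_sub: "B v \<subseteq> ?E" for v by (auto simp: B_def out_arcs_def)
  have fin_B: "finite (B v)" for v using B_sub fin'(3) finite_subset by blast
  have disj_B: "B v \<inter> B w = {}" if "v \<noteq> w" for v w using that by (auto simp: B_def out_arcs_def)
  obtain y where y: "y \<in> V" using ne by blast
  define one_face where "one_face \<rho> \<longleftrightarrow> cyclic_on (\<rho> \<circ> swap_in ?E) ?E" for \<rho>

  have "rotations_on B {} = {id}" by (auto simp: rotations_on_def)
  moreover have "fact (n - 1) \<le> card (cyclic_perms (B u))" if "u \<in> U" for u
    using card_cyclic_perms_ge[OF fin_B[of u]] that ne card by (simp add: B_U card_cartesian_product)
  ultimately have at_U: "fact (n - 1) ^ n \<le> card (rotations_on B U)"
    using card_rotations_on_Un[where ?W0.0 = "{}" and W = U and B = B and N = "fact (n - 1)"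
        and P = "\<lambda>_. True"] fin' fin_B disj_B card
    by simp

  have "fact (n - 1) * card {\<rho> \<in> rotations_on B U. True}
      \<le> card {\<rho> \<in> rotations_on B (insert y U). one_face \<rho>}"
  proof (rule card_rotations_on_insert)
    fix \<rho> assume "\<rho> \<in> rotations_on B U"
    then have "{c \<in> cyclic_perms (B y). one_face (c \<circ> \<rho>)} = cyclic_perms (B y)"
      using cyclic_on_first_vertex[OF E verts(2) ne(1) y B_U] B_V[OF y] by (auto simp: one_face_def)
    then show "fact (n - 1) \<le> card {c \<in> cyclic_perms (B y). one_face (c \<circ> \<rho>)}"
      using card_cyclic_perms_ge[OF fin_B[of y]] B_V[OF y] card ne
      by (simp add: card_cartesian_product)
  next
    show "B y \<inter> (\<Union>w\<in>U. B w) = {}" using verts y B_U B_V by auto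
  qed (use fin' fin_B in auto)
  then have at_y: "fact (n - 1) * fact (n - 1) ^ n
      \<le> card {\<rho> \<in> rotations_on B (insert y U). one_face \<rho>}"
    using order_trans[OF mult_le_mono2[OF at_U]] by simp

  have "?d ^ card (V - {y}) * card {\<rho> \<in> rotations_on B (insert y U). one_face \<rho>}
      \<le> card {\<rho> \<in> rotations_on B (insert y U \<union> (V - {y})). one_face \<rho>}"
  proof (rule card_rotations_on_Un)
    fix \<rho> v W'
    assume v: "v \<in> V - {y}" and \<rho>: "\<rho> \<in> rotations_on B W'" "one_face \<rho>"
    have "\<rho> permutes ?E"
      using \<rho>(1) B_sub by (auto simp: rotations_on_def intro: permutes_subset)
    moreover have "bij (swap_in ?E)"
      by (rule involuntory_imp_bij) (use E in \<open>auto simp: swap_in_def\<close>)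
    then have "swap_in ?E permutes ?E"
      by (simp add: permutes_def bij_iff) (simp add: swap_in_def)
    ultimately have "\<rho> \<circ> swap_in ?E permutes ?E" by (intro permutes_compose)
    moreover have "card (B v) = n" using B_V v card by (simp add: card_cartesian_product)
    ultimately show "?d \<le> card {c \<in> cyclic_perms (B v). one_face (c \<circ> \<rho>)}"
      using card_one_cycle_extensions[OF _ _ B_sub, of "\<rho> \<circ> swap_in ?E" v] \<rho>(2) \<open>odd n\<close>
      by (simp add: one_face_def o_assoc)
  qed (use fin' fin_B disj_B verts y in auto)
  moreover have "insert y U \<union> (V - {y}) = U \<union> V" "card (V - {y}) = n - 1"
    using y card fin' by auto
  ultimately have at_V: "?d ^ (n - 1) * (fact (n - 1) * fact (n - 1) ^ n)
      \<le> card {\<rho> \<in> rotations_on B (U \<union> V). one_face \<rho>}" (is "_ \<le> card ?R")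
    using order_trans[OF mult_le_mono2[OF at_y]] by simp

  have "2 ^ ((n - 1) div 2) * ?d ^ n * fact (n - 1) ^ n
      = ?d ^ (n - 1) * ((2 ^ m * ?d) * fact (n - 1) ^ n)"
    using power_Suc[of ?d "n - 1"] by (simp add: n ac_simps)
  also have "\<dots> \<le> ?d ^ (n - 1) * (fact (n - 1) * fact (n - 1) ^ n)"
    using fact_ge_double_fact[of m] by (intro mult_le_mono) (auto simp: n)
  also note at_V
  also have "card ?R \<le> card (max_genus_embeddings G)"
  proof (rule card_mono)
    show "finite (max_genus_embeddings G)"
      using finite_permutations[OF fin'(3)]
      by (rule rev_finite_subset) (auto simp: max_genus_embeddings_def rotation_system_def)
    show "?R \<subseteq> max_genus_embeddings G"
    proof
      fix \<rho> assume \<rho>: "\<rho> \<in> ?R"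
      have "(\<Union>v\<in>U \<union> V. B v) = ?E" using verts E by (auto simp: B_def out_arcs_def)
      then have rot: "rotation_system G \<rho>"
        using \<rho> verts by (auto simp: rotations_on_def rotation_system_def B_def)
      have face: "card (faces G \<rho>) = 1"
        using \<rho> by (simp add: faces_of_one_cycle one_face_def)
      \<comment> \<open>The cycle rank \<open>(n - 1)\<^sup>2\<close> is even, so the genus of a one-face embedding is its half.\<close>
      have "has_genus G \<rho> (2 * m\<^sup>2)"
        using face verts fin' card card_undirected_edges_complete_bipartite[OF E verts(2)]
        by (simp add: has_genus_def card_Un_disjoint n power2_eq_square algebra_simps)
      moreover have "?E \<noteq> {}" using E ne by auto
      ultimately show "\<rho> \<in> max_genus_embeddings G"
        using max_genus_eq_of_one_face[OF fin'(3) _ rot _ face] rot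
        by (auto simp: max_genus_embeddings_def)
    qed
  qed
  finally show ?thesis .
qed

end
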